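(* Let $\Lambda$ be a nonzero real number and let $p(z)=\prod_{i=1}^n(z-x_i)$ and $q(z)=\prod_{i=1}^m(z-y_i)$ be complex polynomials which have no multiple roots and no common roots. (1) One has $$\operatorname{Res}_{z=x_i}\frac{q(z)^{2\Lambda}}{p(z)^2}=0\ \ (i=1,\dots,n)\quad\text{and}\quad \operatorname{Res}_{z=y_i}\frac{p(z)^{2/\Lambda}}{q(z)^2}=0\ \ (i=1,\dots,m)$$ if and only if, identically in $z$, $$p''(z)q(z)-2\Lambda p'(z)q'(z)+\Lambda^2p(z)q''(z)=0.\qquad( * )$$ (2) Both indefinite integrals $$\int\frac{q(z)^{2\Lambda}}{p(z)^2}\,dz,\qquad \int\frac{p(z)^{2/\Lambda}}{q(z)^2}\,dz$$ are rational if and only if $p,q$ satisfy $( * )$ with $\Lambda=1/2$, $1$ or $2$ (that is, if and only if $\Lambda\in\{1/2,1,2\}$ and $( * )$ holds for this $\Lambda$).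
   Context: Primes denote derivatives with respect to the complex variable $z$. When $2\Lambda$ or $2/\Lambda$ is not an integer, $q^{2\Lambda}$ (resp. $p^{2/\Lambda}$) denotes any holomorphic branch of the power in a neighbourhood of $x_i$ (resp. $y_i$), where $q$ (resp. $p$) does not vanish; whether the residue vanishes does not depend on the branch. An indefinite integral is called rational if it is a rational function of $z$, i.e. expressible without logarithms.
   Formalization: In (2), "rational implies Λ∈{1/2,1,2} and ( * )" is stated only for n+m≥2 (automatic if n,m≥1): with empty products allowed it fails, e.g. p=q=1 with any Λ, or p=z−x_1, q=1, Λ=2/3. The converse is stated for all n,m. *)

theory Defs
  imports "HOL-Complex_Analysis.Complex_Analysis" "HOL-Computational_Algebra.Polynomial"
begin

text \<open>A holomorphic branch on \<open>U\<close> of the power \<open>f\<close> to the \<open>a\<close> is \<open>exp (a * h)\<close> for a holomorphic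
  logarithm \<open>h\<close> of \<open>f\<close>; in particular \<open>f\<close> has no zero in \<open>U\<close>. For integer \<open>a\<close> this is
  the ordinary power, whatever \<open>h\<close> is.\<close>

definition power_branch_on ::
    "(complex \<Rightarrow> complex) \<Rightarrow> (complex \<Rightarrow> complex) \<Rightarrow> real \<Rightarrow> complex set \<Rightarrow> bool" where
  "power_branch_on g f a U \<longleftrightarrow>
     (\<exists>h. h holomorphic_on U \<and> (\<forall>z\<in>U. exp (h z) = f z) \<and>
          (\<forall>z\<in>U. g z = exp (of_real a * h z)))"

definition power_branch_near ::
    "(complex \<Rightarrow> complex) \<Rightarrow> (complex \<Rightarrow> complex) \<Rightarrow> real \<Rightarrow> complex \<Rightarrow> bool" where
  "power_branch_near g f a w \<longleftrightarrow> (\<exists>U. open U \<and> w \<in> U \<and> power_branch_on g f a U)"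

lemma power_branch_on_int:
  assumes "power_branch_on g f (of_int k) U" "z \<in> U"
  shows "g z = f z powi k"
  using assms unfolding power_branch_on_def by (auto simp: exp_power_int[symmetric])

lemma power_branch_near_exists:
  assumes "f holomorphic_on S" "open S" "w \<in> S" "f w \<noteq> 0"
  shows "\<exists>g. power_branch_near g f a w"
proof -
  define U where "U = {z \<in> S. f z / f w \<in> ball 1 1}"
  define h where "h = (\<lambda>z. Ln (f z / f w) + Ln (f w))"
  have cont: "continuous_on S (\<lambda>z. f z / f w)"
    using assms by (intro continuous_intros holomorphic_on_imp_continuous_on) auto
  have "open (S \<inter> (\<lambda>z. f z / f w) -` ball 1 1)"
    using cont assms(2) by (intro continuous_open_preimage) auto
  moreover have "S \<inter> (\<lambda>z. f z / f w) -` ball 1 1 = U"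
    by (auto simp: U_def)
  ultimately have "open U" by simp
  have "w \<in> U"
    using assms by (simp add: U_def)
  have pos: "f z / f w \<notin> \<real>\<^sub>\<le>\<^sub>0" if "z \<in> U" for z
  proof -
    have "norm (1 - f z / f w) < 1"
      using that by (simp add: U_def dist_norm)
    then have "Re (1 - f z / f w) < 1"
      using complex_Re_le_cmod[of "1 - f z / f w"] by linarith
    then have "Re (f z / f w) > 0"
      unfolding minus_complex.sel one_complex.sel by linarith
    then show ?thesis
      unfolding complex_nonpos_Reals_iff by linarith
  qed
  have "f holomorphic_on U"
    using assms(1) by (rule holomorphic_on_subset) (auto simp: U_def)
  then have "h holomorphic_on U"
    unfolding h_def using pos assms(4) by (intro holomorphic_intros) auto
  moreover have "exp (h z) = f z" if "z \<in> U" for z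
  proof -
    have "f z / f w \<noteq> 0"
      using pos[OF that] by (metis nonpos_Reals_zero_I)
    then show ?thesis
      using assms(4) unfolding h_def by (simp add: exp_add)
  qed
  ultimately have "power_branch_on (\<lambda>z. exp (of_real a * h z)) f a U"
    unfolding power_branch_on_def by blast
  then show ?thesis
    unfolding power_branch_near_def using \<open>open U\<close> \<open>w \<in> U\<close> by blast
qed

text \<open>Used for \<open>f\<close> a holomorphic branch on a nonempty connected open \<open>U\<close>; by the identity
  theorem the rational function \<open>r / s\<close> is then unique up to an additive constant and
  does not change when \<open>U\<close> is shrunk.\<close>

definition has_rational_antiderivative_on :: "(complex \<Rightarrow> complex) \<Rightarrow> complex set \<Rightarrow> bool" where
  "has_rational_antiderivative_on f U \<longleftrightarrow>
     (\<exists>r s :: complex poly. \<forall>z\<in>U. poly s z \<noteq> 0 \<and>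
        ((\<lambda>w. poly r w / poly s w) has_field_derivative f z) (at z))"

definition bilinear_eq :: "real \<Rightarrow> complex poly \<Rightarrow> complex poly \<Rightarrow> bool" where
  "bilinear_eq \<Lambda> p q \<longleftrightarrow>
     (\<forall>z. poly (pderiv (pderiv p)) z * poly q z
          - 2 * of_real \<Lambda> * poly (pderiv p) z * poly (pderiv q) z
          + (of_real \<Lambda>)\<^sup>2 * poly p z * poly (pderiv (pderiv q)) z = 0)"

end

theory Submission
  imports Defs "HOL-Computational_Algebra.Fundamental_Theorem_Algebra"
begin

text \<open>A branch \<open>g\<close> of \<open>q\<close> to the \<open>c\<close> enters only through \<open>g' q = c q' g\<close>. At a simple zero \<open>a\<close>
  of \<open>p\<close> this shows that \<open>g / p\<^sup>2\<close> has residue zero iff \<open>p'' q = c p' q'\<close> at \<open>a\<close>. With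
  \<open>c = 2 \<Lambda>\<close>, and symmetrically for \<open>q\<close>, this says that the left-hand side of the bilinear
  equation vanishes at all zeros of \<open>p q\<close>, hence identically, its degree being too small.

  A rational antiderivative \<open>R\<close> of \<open>g / p\<^sup>2\<close> makes \<open>g = p\<^sup>2 R'\<close> rational. Comparing orders in
  \<open>g' q = c q' g\<close> shows that \<open>c\<close> is the order of \<open>g\<close> at each zero of \<open>q\<close>, so an integer, and
  that \<open>g\<close> has neither zero nor pole at the zeros of \<open>p\<close>, so the residue criterion applies
  there. The leading coefficient of the bilinear equation excludes \<open>\<Lambda> < 0\<close>. Conversely
  \<open>g = q ^ k\<close> is a polynomial, and vanishing residues allow an explicit integration.\<close>

section \<open>Polynomials\<close>

text \<open>A nonempty open set is infinite, while a nonzero difference has finitely many roots.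
  This carries identities from the domain of a branch to the whole plane.\<close>

lemma poly_eqI_open:
  fixes A B :: "complex poly"
  assumes "open U" "U \<noteq> {}" "\<And>z. z \<in> U \<Longrightarrow> poly A z = poly B z"
  shows "A = B"
proof (rule ccontr)
  assume "A \<noteq> B"
  then have "finite {z. poly (A - B) z = 0}"
    by (intro poly_roots_finite) auto
  then have "finite U"
    by (rule rev_finite_subset) (use assms(3) in auto)
  then show False
    using assms(1,2) finite_imp_not_open by blast
qed

text \<open>The remainder of \<open>A\<close> modulo \<open>p\<close> inherits all roots of
  \<open>p\<close>, and these number \<open>degree p\<close>, more than a nonzero remainder can
  have.\<close>

lemma rsquarefree_dvdI:
  fixes p A :: "complex poly"
  assumes "rsquarefree p" "\<And>a. poly p a = 0 \<Longrightarrow> poly A a = 0"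
  shows "p dvd A"
proof (rule ccontr)
  assume "\<not> p dvd A"
  then have nz: "A mod p \<noteq> 0" by auto
  have "p \<noteq> 0" using assms(1) by (auto simp: rsquarefree_def)
  then have deg: "degree (A mod p) < degree p"
    using degree_mod_less nz by blast
  have "{a. poly p a = 0} \<subseteq> {a. poly (A mod p) a = 0}"
    using assms(2) by (auto simp: poly_mod)
  then have "card {a. poly p a = 0} \<le> card {a. poly (A mod p) a = 0}"
    by (intro card_mono poly_roots_finite nz)
  also have "\<dots> \<le> degree (A mod p)"
    using nz by (rule card_poly_roots_bound)
  also have "\<dots> < degree p" by (rule deg)
  \<comment> \<open>Over the complex numbers a squarefree \<open>p\<close> splits into distinct
    linear factors, so its degree counts its roots.\<close>
  also have "degree p = degree (smult (lead_coeff p) (\<Prod>z|poly p z = 0. [:- z, 1:]))"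
    by (simp only: complex_poly_decompose_rsquarefree[OF assms(1)])
  also have "\<dots> = card {a. poly p a = 0}"
    using \<open>p \<noteq> 0\<close> by (simp add: degree_prod_sum_eq)
  finally show False by simp
qed

lemma poly_interpolation_exists:
  fixes v :: "'a :: field \<Rightarrow> 'a"
  assumes "finite S"
  shows "\<exists>u. \<forall>a\<in>S. poly u a = v a"
  using assms
proof induction
  case (insert b S)
  then obtain u where u: "\<forall>a\<in>S. poly u a = v a" by blast
  \<comment> \<open>\<open>w\<close> vanishes on \<open>S\<close> but not at \<open>b\<close>, so a
    multiple of it adjusts the value at \<open>b\<close> and keeps those on
    \<open>S\<close>.\<close>
  define w where "w = (\<Prod>a\<in>S. [:- a, 1:])"
  have w: "poly w a = 0 \<longleftrightarrow> a \<in> S" for a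
    using insert by (auto simp: w_def poly_prod)
  have "\<forall>a\<in>insert b S. poly (u + smult ((v b - poly u b) / poly w b) w) a = v a"
    using u w insert by auto
  then show ?case by blast
qed auto

lemma poly_antiderivative_exists:
  fixes g :: "'a :: field_char_0 poly"
  shows "\<exists>G. pderiv G = g"
proof -
  define G where "G = (\<Sum>i\<le>degree g. monom (coeff g i / of_nat (Suc i)) (Suc i))"
  have "pderiv G = (\<Sum>i\<le>degree g. monom (coeff g i) i)"
    unfolding G_def higher_pderiv_sum[of 1, simplified] pderiv_monom
    by (intro sum.cong) (auto simp del: of_nat_Suc)
  then show ?thesis
    using poly_as_sum_of_monoms[of g] by auto
qed

text \<open>\<open>m\<close> and \<open>n\<close> are bounds rather than exact degrees, because the
  factors X f' and X^2 f'' used below can have smaller degree than f or be zero.\<close>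

lemma coeff_mult_add_degree_le:
  assumes "degree p \<le> m" "degree q \<le> n"
  shows "coeff (p * q) (m + n) = coeff p m * coeff q n"
proof -
  have "coeff p i * coeff q (m + n - i) = 0" if "i \<le> m + n" "i \<noteq> m" for i
  proof (cases "i < m")
    case True
    then show ?thesis using assms by (simp add: coeff_eq_0)
  next
    case False
    then have "degree p < i" using that assms by simp
    then show ?thesis by (simp add: coeff_eq_0)
  qed
  then have "coeff (p * q) (m + n) = (\<Sum>i\<in>{m}. coeff p i * coeff q (m + n - i))"
    unfolding coeff_mult by (intro sum.mono_neutral_right) auto
  then show ?thesis by simp
qed

section \<open>Orders of zeros in the equation g' q = c q' g\<close>

lemma mult_pderiv_linear_power:
  fixes p :: "'a :: idom poly"
  shows "[:- a, 1:] * pderiv ([:- a, 1:] ^ n * p)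
    = [:- a, 1:] ^ n * (of_nat n * p + [:- a, 1:] * pderiv p)"
proof (cases n)
  case (Suc k)
  have *: "pderiv [:- a, 1:] = 1" by (simp add: pderiv_pCons)
  have sm: "smult (of_nat j) f = of_nat j * f" for j and f :: "'a poly"
    by (simp add: of_nat_poly)
  show ?thesis
    unfolding Suc pderiv_mult pderiv_power_Suc * sm
    by (simp add: algebra_simps del: mult_pCons_left mult_pCons_right)
qed simp

text \<open>For g = N/D, \<open>eq\<close> is g' q = c q' g multiplied by D^2. It equates the
  logarithmic derivative of g with c q'/q: the former has residue
  \<open>order a N - order a D\<close> at \<open>a\<close>, the latter 0 or c according as q is
  nonzero or has a simple zero there. N1/D1 is g freed of its zero or pole at
  \<open>a\<close>.\<close>

lemma log_derivative_order:
  fixes N D q :: "complex poly"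
  assumes "N \<noteq> 0" "D \<noteq> 0"
    and eq: "(pderiv N * D - N * pderiv D) * q = smult c (pderiv q * N * D)"
  obtains N1 D1 where "N = [:- a, 1:] ^ order a N * N1" "D = [:- a, 1:] ^ order a D * D1"
    "poly N1 a \<noteq> 0" "poly D1 a \<noteq> 0"
    "poly q a \<noteq> 0 \<Longrightarrow> order a N = order a D"
    "poly q a \<noteq> 0 \<Longrightarrow>
       (pderiv N1 * D1 - N1 * pderiv D1) * q = smult c (pderiv q * N1 * D1)"
    "poly q a = 0 \<Longrightarrow> poly (pderiv q) a \<noteq> 0 \<Longrightarrow>
       c = of_nat (order a N) - of_nat (order a D)"
proof -
  define L where "L = [:- a, 1:]"
  define \<alpha> where "\<alpha> = order a N"
  define \<beta> where "\<beta> = order a D"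
  have L0: "L \<noteq> 0" "poly L a = 0" "poly (pderiv L) a = 1"
    by (auto simp: L_def pderiv_pCons)
  obtain N1 where N1: "N = L ^ \<alpha> * N1" "\<not> L dvd N1"
    using order_decomp[OF assms(1), of a] unfolding L_def \<alpha>_def by blast
  obtain D1 where D1: "D = L ^ \<beta> * D1" "\<not> L dvd D1"
    using order_decomp[OF assms(2), of a] unfolding L_def \<beta>_def by blast
  have nz: "poly N1 a \<noteq> 0" "poly D1 a \<noteq> 0"
    using N1(2) D1(2) by (auto simp: poly_eq_0_iff_dvd L_def)
  define W where "W = pderiv N1 * D1 - N1 * pderiv D1"
  \<comment> \<open>The order of N/D at \<open>a\<close>, as a constant polynomial.\<close>
  define K :: "complex poly" where "K = of_nat \<alpha> - of_nat \<beta>"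
  \<comment> \<open>Multiplying derivatives by \<open>L\<close> keeps the exponents at \<alpha> and
    \<beta>, so order 0 needs no separate treatment.\<close>
  have dN: "L * pderiv N = L ^ \<alpha> * (of_nat \<alpha> * N1 + L * pderiv N1)"
    and dD: "L * pderiv D = L ^ \<beta> * (of_nat \<beta> * D1 + L * pderiv D1)"
    unfolding N1 D1 unfolding L_def by (rule mult_pderiv_linear_power)+
  have "L * (pderiv N * D - N * pderiv D) = (L * pderiv N) * D - N * (L * pderiv D)"
    by (simp add: algebra_simps)
  also have "\<dots> = L ^ \<alpha> * L ^ \<beta> * (K * N1 * D1 + L * W)"
    unfolding dN dD unfolding N1(1) D1(1) K_def W_def by (simp add: algebra_simps)
  finally have e1: "L * (pderiv N * D - N * pderiv D) = L ^ \<alpha> * L ^ \<beta> * (K * N1 * D1 + L * W)" .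
  have "L ^ \<alpha> * L ^ \<beta> * ((K * N1 * D1 + L * W) * q)
      = L * ((pderiv N * D - N * pderiv D) * q)"
    unfolding mult.assoc[symmetric] using e1 by (simp add: mult.assoc)
  also have "\<dots> = L * smult c (pderiv q * N * D)"
    by (simp only: eq)
  also have "\<dots> = L ^ \<alpha> * L ^ \<beta> * (L * smult c (pderiv q * N1 * D1))"
    unfolding N1(1) D1(1) by (simp add: algebra_simps)
  finally have "L ^ \<alpha> * L ^ \<beta> * ((K * N1 * D1 + L * W) * q)
      = L ^ \<alpha> * L ^ \<beta> * (L * smult c (pderiv q * N1 * D1))" .
  \<comment> \<open>With the common power of \<open>L\<close> cancelled, evaluation at
    \<open>a\<close> leaves only K N1 D1 q = 0.\<close>
  then have e2: "(K * N1 * D1 + L * W) * q = L * smult c (pderiv q * N1 * D1)"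
    using L0(1) by (simp del: mult_smult_right)
  have Ka: "poly K a = of_nat \<alpha> - of_nat \<beta>"
    by (simp add: K_def)
  have A: "\<alpha> = \<beta>" if "poly q a \<noteq> 0"
  proof -
    have "poly ((K * N1 * D1 + L * W) * q) a = poly (L * smult c (pderiv q * N1 * D1)) a"
      using e2 by simp
    then have "poly K a = 0"
      using that nz L0(2) by simp
    then show ?thesis
      using Ka by simp
  qed
  have B: "W * q = smult c (pderiv q * N1 * D1)" if "poly q a \<noteq> 0"
  proof -
    have "K = 0" using A[OF that] by (simp add: K_def)
    then have "L * (W * q) = L * smult c (pderiv q * N1 * D1)"
      using e2 by (simp add: algebra_simps)
    then show ?thesis
      using L0(1) mult_left_cancel by blast
  qed
  have C: "c = of_nat \<alpha> - of_nat \<beta>" if q: "poly q a = 0" "poly (pderiv q) a \<noteq> 0"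
  proof -
    obtain q1 where q1: "q = L * q1"
      using q(1) unfolding poly_eq_0_iff_dvd L_def dvd_def by blast
    have q1a: "poly (pderiv q) a = poly q1 a"
      unfolding q1 pderiv_mult using L0 by simp
    \<comment> \<open>At a simple zero of q a further factor \<open>L\<close> cancels, and the
      values at \<open>a\<close> now compare K with c because q1(a) = q'(a).\<close>
    have "L * ((K * N1 * D1 + L * W) * q1) = L * smult c (pderiv q * N1 * D1)"
      using e2 unfolding q1 by (simp add: algebra_simps)
    then have "(K * N1 * D1 + L * W) * q1 = smult c (pderiv q * N1 * D1)"
      using L0(1) mult_left_cancel by blast
    then have "poly ((K * N1 * D1 + L * W) * q1) a = poly (smult c (pderiv q * N1 * D1)) a"
      by simp
    then have "poly K a = c"
      using nz q(2) L0(2) q1a by simp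
    then show ?thesis using Ka by simp
  qed
  show ?thesis
    by (rule that[of N1 D1])
      (use N1(1) D1(1) nz A B C in \<open>auto simp: L_def \<alpha>_def \<beta>_def W_def\<close>)
qed

section \<open>The bilinear equation\<close>

text \<open>The left-hand side as a polynomial, so that its degree and its divisibility by p q can
  be used.\<close>

definition bilinear_poly :: "real \<Rightarrow> complex poly \<Rightarrow> complex poly \<Rightarrow> complex poly" where
  "bilinear_poly \<Lambda> p q = pderiv (pderiv p) * q - smult (2 * of_real \<Lambda>) (pderiv p * pderiv q)
     + smult ((of_real \<Lambda>)\<^sup>2) (p * pderiv (pderiv q))"

lemma bilinear_eq_iff_poly: "bilinear_eq \<Lambda> p q \<longleftrightarrow> bilinear_poly \<Lambda> p q = 0"
proof -
  have "bilinear_eq \<Lambda> p q \<longleftrightarrow> (\<forall>z. poly (bilinear_poly \<Lambda> p q) z = 0)"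
    by (simp add: bilinear_eq_def bilinear_poly_def mult.assoc)
  then show ?thesis
    by (simp add: poly_all_0_iff_0)
qed

text \<open>Multiplying by \<open>X^2\<close> keeps all degrees in a range where \<open>n - 2\<close> is not truncated.\<close>

lemma bilinear_eq_lead_coeff:
  assumes "bilinear_eq \<Lambda> p q" "lead_coeff p = 1" "lead_coeff q = 1"
    and n: "degree p = n" and m: "degree q = m"
  shows "real n * (real n - 1) - 2 * \<Lambda> * real n * real m + \<Lambda>\<^sup>2 * real m * (real m - 1) = 0"
proof -
  \<comment> \<open>\<open>t f\<close> is X f' and \<open>s f\<close> is X^2 f''. They multiply X^k
    by k and k (k - 1), which preserves degree bounds.\<close>
  define t :: "complex poly \<Rightarrow> complex poly" where "t = (\<lambda>f. pCons 0 (pderiv f))"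
  define s :: "complex poly \<Rightarrow> complex poly" where "s = (\<lambda>f. pCons 0 (pCons 0 (pderiv (pderiv f))))"
  have dt: "degree (t f) \<le> degree f" "coeff (t f) (degree f) = of_nat (degree f) * lead_coeff f" for f
  proof -
    show "coeff (t f) (degree f) = of_nat (degree f) * lead_coeff f"
      by (cases "degree f") (auto simp: t_def coeff_pderiv)
    show "degree (t f) \<le> degree f"
      by (rule degree_le) (auto simp: t_def coeff_pCons coeff_pderiv coeff_eq_0 split: nat.split)
  qed
  have ds: "degree (s f) \<le> degree f"
    "coeff (s f) (degree f) = of_nat (degree f) * (of_nat (degree f) - 1) * lead_coeff f" for f
  proof -
    show "coeff (s f) (degree f) = of_nat (degree f) * (of_nat (degree f) - 1) * lead_coeff f"
      by (auto simp: s_def coeff_pderiv coeff_pCons algebra_simps split: nat.split)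
    show "degree (s f) \<le> degree f"
      by (rule degree_le) (auto simp: s_def coeff_pCons coeff_pderiv coeff_eq_0 split: nat.split)
  qed
  have "s p * q - smult (2 * of_real \<Lambda>) (t p * t q) + smult ((of_real \<Lambda>)\<^sup>2) (p * s q)
      = pCons 0 (pCons 0 (bilinear_poly \<Lambda> p q))"
    by (simp add: s_def t_def bilinear_poly_def)
  then have e: "coeff (s p * q) (n + m) - 2 * of_real \<Lambda> * coeff (t p * t q) (n + m)
      + (of_real \<Lambda>)\<^sup>2 * coeff (p * s q) (n + m) = 0"
    using assms(1) by (simp add: bilinear_eq_iff_poly flip: coeff_add coeff_diff coeff_smult)
  have c: "coeff (s p * q) (n + m) = of_nat n * (of_nat n - 1)"
    "coeff (t p * t q) (n + m) = of_nat n * of_nat m"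
    "coeff (p * s q) (n + m) = of_nat m * (of_nat m - 1)"
    using ds[of p] ds[of q] dt[of p] dt[of q] assms by (simp_all add: coeff_mult_add_degree_le)
  have "complex_of_real (real n * (real n - 1) - 2 * \<Lambda> * real n * real m
      + \<Lambda>\<^sup>2 * real m * (real m - 1)) = 0"
    using e unfolding c by (simp add: mult.assoc)
  then show ?thesis
    unfolding of_real_eq_0_iff .
qed

text \<open>The leading coefficients give n (n-1) + \<Lambda>^2 m (m-1) = 2 \<Lambda> n m with a
  nonnegative left side. If the right side were not positive, both terms on the left would vanish,
  so n, m <= 1 with one of them 0, against n + m >= 2.\<close>

lemma bilinear_eq_imp_pos:
  assumes "bilinear_eq \<Lambda> p q" "lead_coeff p = 1" "lead_coeff q = 1" "\<Lambda> \<noteq> 0"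
    and "2 \<le> degree p + degree q"
  shows "0 < \<Lambda> \<and> 0 < degree p \<and> 0 < degree q"
proof -
  define n where "n = degree p"
  define m where "m = degree q"
  have nn: "0 \<le> real k * (real k - 1)" for k :: nat
    by (cases k) auto
  have 0: "real n * (real n - 1) + \<Lambda>\<^sup>2 * (real m * (real m - 1)) = 2 * \<Lambda> * (real n * real m)"
    using bilinear_eq_lead_coeff[OF assms(1-3) refl refl] unfolding n_def m_def
    by (simp add: algebra_simps)
  have "\<not> 2 * \<Lambda> * (real n * real m) \<le> 0"
  proof
    assume le: "2 * \<Lambda> * (real n * real m) \<le> 0"
    have a: "0 \<le> real n * (real n - 1)" "0 \<le> \<Lambda>\<^sup>2 * (real m * (real m - 1))"
      using nn[of n] nn[of m] by auto
    then have "real n * (real n - 1) = 0" "\<Lambda>\<^sup>2 * (real m * (real m - 1)) = 0"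
      "2 * \<Lambda> * (real n * real m) = 0"
      using 0 le by linarith+
    then have "n = 0 \<or> n = 1" "m = 0 \<or> m = 1" "n = 0 \<or> m = 0"
      using assms(4) by auto
    then show False
      using assms(5) unfolding n_def m_def by auto
  qed
  then have pos: "0 < \<Lambda> * (real n * real m)" by linarith
  have "0 \<le> real n * real m" by simp
  with pos have "0 < \<Lambda>" "0 < real n * real m"
    by (auto simp: zero_less_mult_iff)
  then show ?thesis
    unfolding n_def m_def by (auto simp: zero_less_mult_iff)
qed

text \<open>At a root of p the term with p q'' drops out, at a root of q the one with p'' q.
  Conversely, a polynomial of degree below that of the squarefree product p q is zero once it
  vanishes at all roots of p q.\<close>

lemma bilinear_eq_iff_roots:
  assumes "\<Lambda> \<noteq> 0" "rsquarefree p" "rsquarefree q" "\<nexists>z. poly p z = 0 \<and> poly q z = 0"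
  shows "bilinear_eq \<Lambda> p q \<longleftrightarrow>
     (\<forall>a. poly p a = 0 \<longrightarrow> poly (pderiv (pderiv p)) a * poly q a
            = of_real (2 * \<Lambda>) * poly (pderiv p) a * poly (pderiv q) a) \<and>
     (\<forall>b. poly q b = 0 \<longrightarrow> poly (pderiv (pderiv q)) b * poly p b
            = of_real (2 / \<Lambda>) * poly (pderiv q) b * poly (pderiv p) b)"
    (is "?B \<longleftrightarrow> ?P \<and> ?Q")
proof -
  let ?E = "bilinear_poly \<Lambda> p q"
  have Ep: "poly ?E a = 0 \<longleftrightarrow> poly (pderiv (pderiv p)) a * poly q a
            = of_real (2 * \<Lambda>) * poly (pderiv p) a * poly (pderiv q) a" if "poly p a = 0" for a
    using that by (simp add: bilinear_poly_def mult.assoc)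
  have Eq: "poly ?E b = 0 \<longleftrightarrow> poly (pderiv (pderiv q)) b * poly p b
            = of_real (2 / \<Lambda>) * poly (pderiv q) b * poly (pderiv p) b" if "poly q b = 0" for b
  proof -
    \<comment> \<open>Extracting \<Lambda>^2 turns the coefficient 2 \<Lambda> into 2 / \<Lambda>,
      the exponent of the second integrand.\<close>
    have "poly ?E b = (of_real \<Lambda>)\<^sup>2 * (poly (pderiv (pderiv q)) b * poly p b
            - of_real (2 / \<Lambda>) * poly (pderiv q) b * poly (pderiv p) b)"
      using that assms(1) by (simp add: bilinear_poly_def algebra_simps power2_eq_square)
    then show ?thesis using assms(1) by simp
  qed
  have "?E = 0" if vanish: "\<And>a. poly (p * q) a = 0 \<Longrightarrow> poly ?E a = 0"
  \<comment> \<open>For two constants the strict degree bound would read 0 < 0; there every term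
    contains a vanishing derivative.\<close>
  proof (cases "degree p + degree q = 0")
    case True
    then have "pderiv p = 0" "pderiv q = 0"
      by (simp_all add: pderiv_eq_0_iff)
    then show ?thesis by (simp add: bilinear_poly_def)
  next
    case False
    have nz: "p \<noteq> 0" "q \<noteq> 0"
      using assms by (auto simp: rsquarefree_def)
    have sq: "rsquarefree (p * q)"
      unfolding rsquarefree_roots
    proof (intro allI notI)
      fix a assume a: "poly (p * q) a = 0 \<and> poly (pderiv (p * q)) a = 0"
      then have "poly p a = 0 \<and> poly q a \<noteq> 0 \<or> poly q a = 0 \<and> poly p a \<noteq> 0"
        using assms(4) by auto
      then show False
        using a assms(2,3) unfolding rsquarefree_roots by (auto simp: pderiv_mult)
    qed
    have dvd: "p * q dvd ?E"
      using sq vanish by (rule rsquarefree_dvdI)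
    let ?N = "degree p + degree q"
    have d1: "degree (f * g) < ?N" if "degree f + degree g < ?N" for f g :: "complex poly"
      using degree_mult_le[of f g] that by linarith
    \<comment> \<open>The alternative of a zero derivative is needed since the zero polynomial has
      degree 0, not less than that of a constant.\<close>
    have ddp: "pderiv (pderiv p) = 0 \<or> degree (pderiv (pderiv p)) < degree p"
      "pderiv p = 0 \<or> degree (pderiv p) < degree p"
      and ddq: "pderiv (pderiv q) = 0 \<or> degree (pderiv (pderiv q)) < degree q"
      "pderiv q = 0 \<or> degree (pderiv q) < degree q"
      by (auto simp: degree_pderiv pderiv_eq_0_iff)
    have "degree (pderiv (pderiv p) * q) < ?N"
      using ddp(1) False by (auto intro: d1)
    moreover have "degree (p * pderiv (pderiv q)) < ?N"
      using ddq(1) False by (auto intro: d1)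
    moreover have "degree (pderiv p * pderiv q) < ?N"
      using ddp(2) ddq(2) False by (auto intro: d1)
    ultimately have "degree ?E < ?N"
      unfolding bilinear_poly_def
      by (intro degree_add_less degree_diff_less) (auto intro: le_less_trans[OF degree_smult_le])
    then show ?thesis
      using dvd nz dvd_imp_degree_le[OF dvd] by (auto simp: degree_mult_eq)
  qed
  then show ?thesis
    unfolding bilinear_eq_iff_poly using Ep Eq by auto
qed

section \<open>Residues and antiderivatives\<close>

text \<open>Differentiating exp h = q gives h' q = q', and g = exp (c h) gives g' = c h' g;
  eliminating h' removes the logarithm.\<close>

lemma power_branch_on_log_derivative:
  assumes "power_branch_on g (poly q) c U" "open U"
  shows "g holomorphic_on U"
    and "z \<in> U \<Longrightarrow> g z \<noteq> 0"
    and "z \<in> U \<Longrightarrow> poly q z \<noteq> 0"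
    and "z \<in> U \<Longrightarrow> deriv g z * poly q z = of_real c * poly (pderiv q) z * g z"
proof -
  obtain h where h: "h holomorphic_on U" "\<And>z. z \<in> U \<Longrightarrow> exp (h z) = poly q z"
    "\<And>z. z \<in> U \<Longrightarrow> g z = exp (of_real c * h z)"
    using assms(1) unfolding power_branch_on_def by blast
  have "(\<lambda>z. exp (of_real c * h z)) holomorphic_on U"
    using h(1) by (intro holomorphic_intros)
  then show "g holomorphic_on U"
    using h(3) holomorphic_cong by metis
  show "z \<in> U \<Longrightarrow> g z \<noteq> 0" using h(3) by simp
  show "z \<in> U \<Longrightarrow> poly q z \<noteq> 0" using h(2) by (metis exp_not_eq_zero)
  assume z: "z \<in> U"
  have dh: "(h has_field_derivative deriv h z) (at z)"
    using h(1) assms(2) z holomorphic_derivI by blast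
  have ev: "\<forall>\<^sub>F w in nhds z. w \<in> U"
    using assms(2) z eventually_nhds_in_open by blast
  have "((\<lambda>w. exp (h w)) has_field_derivative deriv h z * poly q z) (at z)"
    using dh h(2)[OF z] by (auto intro!: derivative_eq_intros)
  moreover have "((\<lambda>w. exp (h w)) has_field_derivative poly (pderiv q) z) (at z)"
    by (rule has_field_derivative_transform_within_open[OF poly_DERIV assms(2) z]) (use h(2) in auto)
  ultimately have 1: "deriv h z * poly q z = poly (pderiv q) z"
    by (rule DERIV_unique)
  have "((\<lambda>w. exp (of_real c * h w)) has_field_derivative of_real c * deriv h z * g z) (at z)"
    using dh h(3)[OF z] by (auto intro!: derivative_eq_intros)
  then have "(g has_field_derivative of_real c * deriv h z * g z) (at z)"
    by (rule has_field_derivative_transform_within_open[OF _ assms(2) z]) (use h(3) in auto)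
  then have "deriv g z = of_real c * deriv h z * g z"
    by (rule DERIV_imp_deriv)
  then show "deriv g z * poly q z = of_real c * poly (pderiv q) z * g z"
    using 1 by (simp add: mult_ac)
qed

text \<open>With p = (z - a) p1 the residue is the derivative of T / p1^2 at \<open>a\<close>, where
  p1 = p' and 2 p1' = p''. \<open>T\<close> is abstract, since it is later either a branch or a
  rational function.\<close>

lemma residue_over_poly_square_eq_0_iff:
  assumes S: "open S" "a \<in> S" and T: "T holomorphic_on S" "T a \<noteq> 0"
    and p: "poly p a = 0" "poly (pderiv p) a \<noteq> 0" and q: "poly q a \<noteq> 0"
    and ode: "deriv T a * poly q a = c * poly (pderiv q) a * T a"
  shows "residue (\<lambda>z. T z / (poly p z)\<^sup>2) a = 0 \<longleftrightarrow>
    poly (pderiv (pderiv p)) a * poly q a = c * poly (pderiv p) a * poly (pderiv q) a"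
proof -
  obtain p1 where p1: "p = [:- a, 1:] * p1"
    using p(1) by (auto simp: poly_eq_0_iff_dvd dvd_def)
  have p1a: "poly p1 a = poly (pderiv p) a" "2 * poly (pderiv p1) a = poly (pderiv (pderiv p)) a"
    unfolding p1 by (simp_all add: pderiv_mult pderiv_pCons pderiv_add pderiv_diff pderiv_smult)
  define S' where "S' = S \<inter> {z. poly p1 z \<noteq> 0}"
  define G where "G = (\<lambda>z. T z / (poly p1 z)\<^sup>2)"
  have "open {z. poly p1 z \<noteq> 0}"
    by (intro open_Collect_neq continuous_intros)
  then have S': "open S'" "a \<in> S'"
    using S p p1a by (auto simp: S'_def)
  have "G holomorphic_on S'"
    unfolding G_def using T(1)
    by (intro holomorphic_intros) (auto simp: S'_def intro: holomorphic_on_subset)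
  then have "residue (\<lambda>z. G z / (z - a) ^ Suc 1) a = deriv G a"
    by (subst residue_holomorphic_over_power[OF S']) auto
  moreover have "(\<lambda>z. G z / (z - a) ^ Suc 1) = (\<lambda>z. T z / (poly p z)\<^sup>2)"
    unfolding p1 G_def by (auto simp: power2_eq_square algebra_simps)
  ultimately have res: "residue (\<lambda>z. T z / (poly p z)\<^sup>2) a = deriv G a" by simp
  have nz: "poly p1 a \<noteq> 0" using p1a p by simp
  have dT: "(T has_field_derivative deriv T a) (at a)"
    using T(1) S holomorphic_derivI by blast
  have "(G has_field_derivative
      (deriv T a * poly p1 a - 2 * poly (pderiv p1) a * T a) / (poly p1 a) ^ 3) (at a)"
    unfolding G_def using nz
    by (auto intro!: derivative_eq_intros dT simp: field_simps power2_eq_square power3_eq_cube)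
  then have "deriv G a = (deriv T a * poly p1 a - 2 * poly (pderiv p1) a * T a) / (poly p1 a) ^ 3"
    by (rule DERIV_imp_deriv)
  then have "deriv G a = 0 \<longleftrightarrow> deriv T a * poly p1 a - 2 * poly (pderiv p1) a * T a = 0"
    using nz by simp
  \<comment> \<open>The factor q(a) is inserted so that \<open>ode\<close> can eliminate
    T'(a).\<close>
  also have "\<dots> \<longleftrightarrow> poly q a * (deriv T a * poly p1 a - 2 * poly (pderiv p1) a * T a) = 0"
    using q by simp
  also have "poly q a * (deriv T a * poly p1 a - 2 * poly (pderiv p1) a * T a)
      = (deriv T a * poly q a) * poly p1 a - poly (pderiv (pderiv p)) a * T a * poly q a"
    unfolding p1a(2)[symmetric] by (simp add: algebra_simps)
  also have "\<dots> = T a * (c * poly (pderiv p) a * poly (pderiv q) a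
      - poly (pderiv (pderiv p)) a * poly q a)"
    unfolding ode p1a(1) by (simp add: algebra_simps)
  finally show ?thesis
    unfolding res using T(2) by auto
qed

section \<open>Necessary conditions for a rational antiderivative\<close>

lemma residue_deriv_eq_0:
  assumes "open S" "a \<in> S" "\<And>z. z \<in> S - {a} \<Longrightarrow> (F has_field_derivative f z) (at z)"
  shows "residue f a = 0"
proof -
  have o: "open (S - {a})" using assms(1) by blast
  have "F holomorphic_on S - {a}"
    using assms(3) o by (auto simp: holomorphic_on_open)
  then have "deriv F holomorphic_on S - {a}"
    using o by (rule holomorphic_deriv)
  moreover have "deriv F z = f z" if "z \<in> S - {a}" for z
    using assms(3)[OF that] by (rule DERIV_imp_deriv)
  ultimately have hol: "f holomorphic_on S - {a}"
    using holomorphic_cong by metis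
  obtain r where r: "r > 0" "cball a r \<subseteq> S"
    using assms(1,2) open_contains_cball by blast
  have "(f has_contour_integral 2 * pi * \<i> * residue f a) (circlepath a r)"
    using assms(1,2) r(1) hol r(2) by (rule base_residue)
  \<comment> \<open>\<open>F\<close> is a single-valued primitive on the punctured set, so the
    integral over the closed circle is zero.\<close>
  moreover have "(f has_contour_integral 0) (circlepath a r)"
  proof (rule Cauchy_theorem_primitive)
    show "(F has_field_derivative f z) (at z within S - {a})" if "z \<in> S - {a}" for z
      using assms(3)[OF that] by (rule has_field_derivative_at_within)
    show "path_image (circlepath a r) \<subseteq> S - {a}"
      using r by (auto simp: subset_iff dist_norm)
  qed auto
  ultimately have "2 * pi * \<i> * residue f a = 0"
    by (metis contour_integral_unique)
  then show ?thesis by simp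
qed

text \<open>On \<open>U\<close> the branch equals the rational function N/D = p^2 (r/s)', so its
  differential equation becomes a polynomial identity, valid also at the zeros of p and q outside
  \<open>U\<close>.\<close>

lemma has_rational_antiderivative_onD:
  fixes p q :: "complex poly"
  assumes p: "rsquarefree p" and q: "rsquarefree q"
    and U: "open U" "U \<noteq> {}" "\<And>z. z \<in> U \<Longrightarrow> poly p z \<noteq> 0"
    and g: "power_branch_on g (poly q) c U"
    and anti: "has_rational_antiderivative_on (\<lambda>z. g z / (poly p z)\<^sup>2) U"
  shows "poly p a = 0 \<Longrightarrow> poly q a \<noteq> 0 \<Longrightarrow> poly (pderiv (pderiv p)) a * poly q a
      = of_real c * poly (pderiv p) a * poly (pderiv q) a"
    and "poly q b = 0 \<Longrightarrow> c \<in> \<int>"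
proof -
  obtain r s where rs: "\<And>z. z \<in> U \<Longrightarrow> poly s z \<noteq> 0"
    "\<And>z. z \<in> U \<Longrightarrow> ((\<lambda>w. poly r w / poly s w) has_field_derivative g z / (poly p z)\<^sup>2) (at z)"
    using anti unfolding has_rational_antiderivative_on_def by blast
  note br = power_branch_on_log_derivative[OF g U(1)]
  define W where "W = pderiv r * s - r * pderiv s"
  define N where "N = p\<^sup>2 * W"
  define D where "D = s\<^sup>2"
  have dquot: "((\<lambda>w. poly r w / poly s w) has_field_derivative poly W z / poly D z) (at z)"
    if "poly s z \<noteq> 0" for z
    unfolding W_def D_def using that
    by (auto intro!: derivative_eq_intros simp: power2_eq_square)
  have gND: "g z = poly N z / poly D z" and Dz: "poly D z \<noteq> 0" if z: "z \<in> U" for z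
  proof -
    have "g z / (poly p z)\<^sup>2 = poly W z / poly D z"
      using rs(2)[OF z] dquot[OF rs(1)[OF z]] by (rule DERIV_unique)
    then show "g z = poly N z / poly D z"
      using U(3)[OF z] by (simp add: N_def field_simps)
    show "poly D z \<noteq> 0" using rs(1)[OF z] by (simp add: D_def)
  qed
  obtain u where u: "u \<in> U" using U(2) by blast
  have nz: "N \<noteq> 0" "D \<noteq> 0" "s \<noteq> 0" "p \<noteq> 0"
    using gND[OF u] Dz[OF u] br(2)[OF u] rs(1)[OF u] U(3)[OF u] by auto
  \<comment> \<open>This is g' q = c q' g times D^2, first on \<open>U\<close> and then
    identically.\<close>
  have ode: "(pderiv N * D - N * pderiv D) * q = smult (of_real c) (pderiv q * N * D)"
  proof (rule poly_eqI_open[OF U(1,2)])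
    fix z assume z: "z \<in> U"
    have "((\<lambda>w. poly N w / poly D w) has_field_derivative
        (poly (pderiv N) z * poly D z - poly N z * poly (pderiv D) z) / (poly D z)\<^sup>2) (at z)"
      using Dz[OF z] by (auto intro!: derivative_eq_intros simp: power2_eq_square)
    then have "(g has_field_derivative
        (poly (pderiv N) z * poly D z - poly N z * poly (pderiv D) z) / (poly D z)\<^sup>2) (at z)"
      by (rule has_field_derivative_transform_within_open[OF _ U(1) z]) (simp add: gND)
    then have "deriv g z * (poly D z)\<^sup>2 =
        poly (pderiv N) z * poly D z - poly N z * poly (pderiv D) z"
      using Dz[OF z] by (simp add: DERIV_imp_deriv)
    then have "(poly (pderiv N) z * poly D z - poly N z * poly (pderiv D) z) * poly q z
        = (deriv g z * poly q z) * (poly D z)\<^sup>2"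
      by (simp add: mult_ac)
    also have "\<dots> = of_real c * poly (pderiv q) z * (g z * poly D z) * poly D z"
      unfolding br(4)[OF z] by (simp add: power2_eq_square)
    also have "g z * poly D z = poly N z"
      using gND[OF z] Dz[OF z] by simp
    finally show "poly ((pderiv N * D - N * pderiv D) * q) z =
        poly (smult (of_real c) (pderiv q * N * D)) z"
      by (simp add: mult_ac)
  qed
  show "c \<in> \<int>" if b: "poly q b = 0"
  proof -
    have "poly (pderiv q) b \<noteq> 0"
      using q b unfolding rsquarefree_roots by blast
    then have "complex_of_real c = of_nat (order b N) - of_nat (order b D)"
      using log_derivative_order[OF nz(1,2) ode, of b] b by blast
    then have "complex_of_real c = complex_of_real (real (order b N) - real (order b D))"
      by simp
    then have "c = real (order b N) - real (order b D)"
      unfolding of_real_eq_iff .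
    then show ?thesis by simp
  qed
  show "poly (pderiv (pderiv p)) a * poly q a
      = of_real c * poly (pderiv p) a * poly (pderiv q) a"
    if a: "poly p a = 0" "poly q a \<noteq> 0"
  proof -
    obtain N1 D1 where f: "N = [:- a, 1:] ^ order a N * N1" "D = [:- a, 1:] ^ order a D * D1"
      "poly N1 a \<noteq> 0" "poly D1 a \<noteq> 0" "order a N = order a D"
      and ode1: "(pderiv N1 * D1 - N1 * pderiv D1) * q = smult (of_real c) (pderiv q * N1 * D1)"
      using log_derivative_order[OF nz(1,2) ode, of a] a(2) by metis
    \<comment> \<open>\<open>T\<close> is N/D with the equal powers of X - a cancelled. It takes the
      place of a branch near \<open>a\<close>, a point outside \<open>U\<close>.\<close>
    define T where "T = (\<lambda>z. poly N1 z / poly D1 z)"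
    \<comment> \<open>Removing these points leaves \<open>a\<close> as the only possible zero of s p
      in \<open>S\<close>, so r/s is a primitive of T/p^2 on \<open>S - {a}\<close>.\<close>
    define F where "F = {z. poly (s * p) z = 0} - {a}"
    define S where "S = {z. poly D1 z \<noteq> 0} - F"
    have "finite F"
      unfolding F_def using nz by (intro finite_Diff poly_roots_finite) simp
    moreover have "open {z. poly D1 z \<noteq> 0}"
      by (intro open_Collect_neq continuous_intros)
    ultimately have "open S"
      unfolding S_def by (intro open_Diff finite_imp_closed)
    moreover have "a \<in> S"
      using f(4) by (simp add: S_def F_def)
    ultimately have S: "open S" "a \<in> S" .
    have T: "T holomorphic_on S" "T a \<noteq> 0"
      unfolding T_def using f(3,4) by (auto intro!: holomorphic_intros simp: S_def)
    have "(T has_field_derivative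
        (poly (pderiv N1) a * poly D1 a - poly N1 a * poly (pderiv D1) a) / (poly D1 a)\<^sup>2) (at a)"
      unfolding T_def using f(4) by (auto intro!: derivative_eq_intros simp: power2_eq_square)
    then have dT: "deriv T a =
        (poly (pderiv N1) a * poly D1 a - poly N1 a * poly (pderiv D1) a) / (poly D1 a)\<^sup>2"
      by (rule DERIV_imp_deriv)
    have "poly ((pderiv N1 * D1 - N1 * pderiv D1) * q) a
        = poly (smult (of_real c) (pderiv q * N1 * D1)) a"
      by (simp only: ode1)
    then have odeT: "deriv T a * poly q a = of_real c * poly (pderiv q) a * T a"
      unfolding dT unfolding T_def using f(4) by (simp add: field_simps power2_eq_square)
    have "residue (\<lambda>z. T z / (poly p z)\<^sup>2) a = 0"
    proof (rule residue_deriv_eq_0[OF S])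
      fix z assume z: "z \<in> S - {a}"
      then have z': "z \<noteq> a" "poly s z \<noteq> 0" "poly p z \<noteq> 0" "poly D1 z \<noteq> 0"
        by (auto simp: S_def F_def)
      have "T z = poly N z / poly D z"
        unfolding T_def by (subst f(1), subst f(2)) (use z' f(5) in simp)
      then have "T z / (poly p z)\<^sup>2 = poly W z / poly D z"
        using z'(3) by (simp add: N_def)
      then show "((\<lambda>w. poly r w / poly s w) has_field_derivative T z / (poly p z)\<^sup>2) (at z)"
        using dquot[OF z'(2)] by simp
    qed
    moreover have "poly (pderiv p) a \<noteq> 0"
      using p a unfolding rsquarefree_roots by blast
    ultimately show ?thesis
      using residue_over_poly_square_eq_0_iff[OF S T a(1) _ a(2) odeT] by blast
  qed
qed

section \<open>Construction of a rational antiderivative\<close>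

text \<open>Writing \<open>A = u' p - u p' + g p\<^sup>2\<close> gives \<open>A / p\<^sup>2 = (u / p)' + g\<close>. Interpolation provides
  \<open>u\<close> with \<open>A + u p'\<close> divisible by \<open>p\<close>, and the hypothesis on the derivative of \<open>A\<close> makes
  it agree with \<open>u' p\<close> to second order at the roots of \<open>p\<close>.\<close>

lemma rational_antiderivative_over_square:
  fixes A p :: "complex poly"
  assumes p: "rsquarefree p"
    and cond: "\<And>a. poly p a = 0 \<Longrightarrow>
      poly (pderiv (pderiv p)) a * poly A a = poly (pderiv p) a * poly (pderiv A) a"
  shows "\<exists>r. \<forall>z. poly p z \<noteq> 0 \<longrightarrow>
    ((\<lambda>w. poly r w / poly p w) has_field_derivative poly A z / (poly p z)\<^sup>2) (at z)"
proof -
  have "p \<noteq> 0" using p by (auto simp: rsquarefree_def)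
  then obtain u where u: "\<forall>a\<in>{a. poly p a = 0}. poly u a = - poly A a / poly (pderiv p) a"
    using poly_interpolation_exists[OF poly_roots_finite,
        of p "\<lambda>a. - poly A a / poly (pderiv p) a"] by blast
  have p': "poly (pderiv p) a \<noteq> 0" if "poly p a = 0" for a
    using p that unfolding rsquarefree_roots by blast
  have ua: "poly u a * poly (pderiv p) a = - poly A a" if "poly p a = 0" for a
    using u that p'[OF that] by simp
  have "p dvd A + u * pderiv p"
    using p by (rule rsquarefree_dvdI) (simp add: ua)
  then obtain v where v: "A + u * pderiv p = p * v" by (auto simp: dvd_def)
  have "p dvd v - pderiv u"
  proof (rule rsquarefree_dvdI[OF p])
    fix a assume a: "poly p a = 0"
    have "poly (pderiv (A + u * pderiv p)) a = poly (pderiv (p * v)) a"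
      using v by simp
    then have e: "poly (pderiv A) a + poly u a * poly (pderiv (pderiv p)) a
        = (poly v a - poly (pderiv u) a) * poly (pderiv p) a"
      using a by (simp add: pderiv_add pderiv_mult algebra_simps)
    \<comment> \<open>A second factor p'(a) is supplied so that u p' can be replaced by -A and
      \<open>cond\<close> applies.\<close>
    have "(poly v a - poly (pderiv u) a) * (poly (pderiv p) a)\<^sup>2
        = (poly (pderiv A) a + poly u a * poly (pderiv (pderiv p)) a) * poly (pderiv p) a"
      unfolding e by (simp add: power2_eq_square)
    also have "\<dots> = poly (pderiv p) a * poly (pderiv A) a
          + (poly u a * poly (pderiv p) a) * poly (pderiv (pderiv p)) a"
      by (simp add: algebra_simps)
    also have "\<dots> = 0"
      unfolding ua[OF a] using cond[OF a] by (simp add: algebra_simps)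
    finally show "poly (v - pderiv u) a = 0"
      using p'[OF a] by simp
  qed
  then obtain g where g: "v = pderiv u + p * g"
    by (metis add.commute diff_add_cancel dvdE)
  obtain G where G: "pderiv G = g"
    using poly_antiderivative_exists by blast
  have A: "A = p * (pderiv u + p * g) - u * pderiv p"
    using v unfolding g by (simp add: eq_diff_eq)
  have "((\<lambda>w. poly (u + G * p) w / poly p w) has_field_derivative poly A z / (poly p z)\<^sup>2) (at z)"
    if z: "poly p z \<noteq> 0" for z
  proof -
    \<comment> \<open>The derivative is computed for u/p + G, which is then put over the common
      denominator p.\<close>
    have "((\<lambda>w. poly u w / poly p w + poly G w) has_field_derivative
        poly A z / (poly p z)\<^sup>2) (at z)"
      unfolding A using z G
      by (auto intro!: derivative_eq_intros simp: field_simps power2_eq_square)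
    moreover have "open {w. poly p w \<noteq> 0}"
      by (intro open_Collect_neq continuous_intros)
    ultimately show ?thesis
      by (rule has_field_derivative_transform_within_open) (use z in \<open>auto simp: field_simps\<close>)
  qed
  then show ?thesis by blast
qed

text \<open>The branch is the polynomial q^k, and \<open>cond\<close> times q^(k-1) is the condition
  for integrating A / p^2 with A = q^k.\<close>

lemma rational_antiderivative_power_branch:
  fixes p q :: "complex poly" and k :: nat
  assumes p: "rsquarefree p" and U: "\<And>z. z \<in> U \<Longrightarrow> poly p z \<noteq> 0"
    and g: "power_branch_on g (poly q) c U" and c: "c = real k" "k > 0"
    and cond: "\<And>a. poly p a = 0 \<Longrightarrow> poly (pderiv (pderiv p)) a * poly q a
      = of_real c * poly (pderiv p) a * poly (pderiv q) a"
  shows "has_rational_antiderivative_on (\<lambda>z. g z / (poly p z)\<^sup>2) U"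
proof -
  have gk: "g z = poly (q ^ k) z" if "z \<in> U" for z
    using power_branch_on_int[of g "poly q" "int k" U z] g c(1) that by simp
  have "\<exists>r. \<forall>z. poly p z \<noteq> 0 \<longrightarrow>
    ((\<lambda>w. poly r w / poly p w) has_field_derivative poly (q ^ k) z / (poly p z)\<^sup>2) (at z)"
  proof (rule rational_antiderivative_over_square[OF p])
    fix a assume a: "poly p a = 0"
    show "poly (pderiv (pderiv p)) a * poly (q ^ k) a = poly (pderiv p) a * poly (pderiv (q ^ k)) a"
    proof (cases k)
      case 0
      then show ?thesis using c by simp
    next
      case (Suc j)
      have "poly (pderiv (pderiv p)) a * poly (q ^ k) a
          = (poly (pderiv (pderiv p)) a * poly q a) * poly q a ^ j"
        by (simp add: Suc)
      also have "\<dots> = poly (pderiv p) a * poly (pderiv (q ^ k)) a"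
        unfolding cond[OF a] Suc pderiv_power_Suc by (simp add: c(1) Suc algebra_simps)
      finally show ?thesis .
    qed
  qed
  then show ?thesis
    unfolding has_rational_antiderivative_on_def using U gk by metis
qed

lemma residue_power_branch_eq_0_iff:
  assumes "rsquarefree p" "poly p a = 0" "power_branch_near g (poly q) c a"
  shows "residue (\<lambda>z. g z / (poly p z)\<^sup>2) a = 0 \<longleftrightarrow>
    poly (pderiv (pderiv p)) a * poly q a = of_real c * poly (pderiv p) a * poly (pderiv q) a"
proof -
  obtain S where S: "open S" "a \<in> S" "power_branch_on g (poly q) c S"
    using assms(3) unfolding power_branch_near_def by blast
  note br = power_branch_on_log_derivative[OF S(3,1)]
  have "poly (pderiv p) a \<noteq> 0"
    using assms(1,2) unfolding rsquarefree_roots by blast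
  then show ?thesis
    using residue_over_poly_square_eq_0_iff[OF S(1,2) br(1) br(2)[OF S(2)] assms(2) _
        br(3)[OF S(2)] br(4)[OF S(2)]] by blast
qed

section \<open>Admissible exponents and the two equivalences\<close>

lemma power_exponent_integral_cases:
  fixes \<Lambda> :: real
  assumes "0 < \<Lambda>" "2 * \<Lambda> \<in> \<int>" "2 / \<Lambda> \<in> \<int>"
  shows "\<Lambda> \<in> {1/2, 1, 2}"
proof -
  obtain k l where kl: "2 * \<Lambda> = of_int k" "2 / \<Lambda> = of_int l"
    using assms(2,3) by (auto elim!: Ints_cases)
  \<comment> \<open>The product of the two exponents is 4 for every \<Lambda>, so k = 2 \<Lambda> is
    a positive divisor of 4.\<close>
  have "real_of_int k * real_of_int l = 4"
    unfolding kl[symmetric] using assms(1) by simp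
  then have "k * l = 4"
    by (simp flip: of_int_mult)
  moreover have "0 < k"
    using kl(1) assms(1) by (metis mult_pos_pos of_int_0_less_iff zero_less_numeral)
  ultimately have "k dvd 4" "0 < k" by (metis dvd_triv_left, simp)
  then have "k \<le> 4" by (simp add: zdvd_imp_le)
  then have "k \<in> {1, 2, 3, 4}" using \<open>0 < k\<close> by auto
  then have "k \<in> {1, 2, 4}" using \<open>k dvd 4\<close> by auto
  then show ?thesis using kl(1) by auto
qed

text \<open>For n + m <= 1 the bilinear equation holds for every \<Lambda>, and for p = q = 1 both
  integrals are always rational. Hence the equivalence for integrals is stated for n + m >= 2, and
  the direction from the equation to rationality again without this bound.\<close>

theorem lemma2:
  fixes \<Lambda> :: real
    and n m :: nat
    and x y :: "nat \<Rightarrow> complex"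
    and p q :: "complex poly"
    and Qx Py :: "nat \<Rightarrow> complex \<Rightarrow> complex"
    and Q P :: "complex \<Rightarrow> complex"
    and U V :: "complex set"
  assumes "\<Lambda> \<noteq> 0"
    and "p = (\<Prod>i=1..n. [:- x i, 1:])"
    and "q = (\<Prod>i=1..m. [:- y i, 1:])"
    and "rsquarefree p" and "rsquarefree q"
    and "\<nexists>z. poly p z = 0 \<and> poly q z = 0"
    and "\<And>i. i \<in> {1..n} \<Longrightarrow> power_branch_near (Qx i) (poly q) (2 * \<Lambda>) (x i)"
    and "\<And>i. i \<in> {1..m} \<Longrightarrow> power_branch_near (Py i) (poly p) (2 / \<Lambda>) (y i)"
    and "open U" and "connected U" and "U \<noteq> {}" and "\<And>z. z \<in> U \<Longrightarrow> poly p z \<noteq> 0"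
    and "power_branch_on Q (poly q) (2 * \<Lambda>) U"
    and "open V" and "connected V" and "V \<noteq> {}" and "\<And>z. z \<in> V \<Longrightarrow> poly q z \<noteq> 0"
    and "power_branch_on P (poly p) (2 / \<Lambda>) V"
  shows "((\<forall>i\<in>{1..n}. residue (\<lambda>z. Qx i z / (poly p z)\<^sup>2) (x i) = 0) \<and>
          (\<forall>i\<in>{1..m}. residue (\<lambda>z. Py i z / (poly q z)\<^sup>2) (y i) = 0)
            \<longleftrightarrow> bilinear_eq \<Lambda> p q)
       \<and> (2 \<le> n + m \<longrightarrow>
          (has_rational_antiderivative_on (\<lambda>z. Q z / (poly p z)\<^sup>2) U \<and>
           has_rational_antiderivative_on (\<lambda>z. P z / (poly q z)\<^sup>2) V
            \<longleftrightarrow> \<Lambda> \<in> {1/2, 1, 2} \<and> bilinear_eq \<Lambda> p q))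
       \<and> (\<Lambda> \<in> {1/2, 1, 2} \<and> bilinear_eq \<Lambda> p q \<longrightarrow>
           has_rational_antiderivative_on (\<lambda>z. Q z / (poly p z)\<^sup>2) U \<and>
           has_rational_antiderivative_on (\<lambda>z. P z / (poly q z)\<^sup>2) V)"
proof -
  note Lambda = assms(1) and p_def = assms(2) and q_def = assms(3)
  note p = assms(4) and q = assms(5) and pq = assms(6)
  \<comment> \<open>The root conditions \<open>condP\<close> and \<open>condQ\<close> link all three
    notions: residues, rational integrals and the bilinear equation.\<close>
  define condP where "condP \<longleftrightarrow> (\<forall>a. poly p a = 0 \<longrightarrow> poly (pderiv (pderiv p)) a * poly q a
    = of_real (2 * \<Lambda>) * poly (pderiv p) a * poly (pderiv q) a)"
  define condQ where "condQ \<longleftrightarrow> (\<forall>b. poly q b = 0 \<longrightarrow> poly (pderiv (pderiv q)) b * poly p b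
    = of_real (2 / \<Lambda>) * poly (pderiv q) b * poly (pderiv p) b)"
  have bil: "bilinear_eq \<Lambda> p q \<longleftrightarrow> condP \<and> condQ"
    unfolding condP_def condQ_def by (rule bilinear_eq_iff_roots[OF Lambda p q pq])
  have root_p: "poly p a = 0 \<longleftrightarrow> (\<exists>i\<in>{1..n}. a = x i)" for a
    unfolding p_def by (auto simp: poly_prod)
  have root_q: "poly q b = 0 \<longleftrightarrow> (\<exists>i\<in>{1..m}. b = y i)" for b
    unfolding q_def by (auto simp: poly_prod)
  have deg: "degree p = n" "degree q = m"
    unfolding p_def q_def by (simp_all add: degree_prod_sum_eq)
  have lead: "lead_coeff p = 1" "lead_coeff q = 1"
    unfolding p_def q_def lead_coeff_prod by simp_all
  have resP: "(\<forall>i\<in>{1..n}. residue (\<lambda>z. Qx i z / (poly p z)\<^sup>2) (x i) = 0) \<longleftrightarrow> condP"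
  proof -
    have "residue (\<lambda>z. Qx i z / (poly p z)\<^sup>2) (x i) = 0 \<longleftrightarrow>
        poly (pderiv (pderiv p)) (x i) * poly q (x i)
          = of_real (2 * \<Lambda>) * poly (pderiv p) (x i) * poly (pderiv q) (x i)"
      if "i \<in> {1..n}" for i
      using that root_p by (intro residue_power_branch_eq_0_iff[OF p _ assms(7)]) auto
    then show ?thesis
      unfolding condP_def root_p by blast
  qed
  have resQ: "(\<forall>i\<in>{1..m}. residue (\<lambda>z. Py i z / (poly q z)\<^sup>2) (y i) = 0) \<longleftrightarrow> condQ"
  proof -
    have "residue (\<lambda>z. Py i z / (poly q z)\<^sup>2) (y i) = 0 \<longleftrightarrow>
        poly (pderiv (pderiv q)) (y i) * poly p (y i)
          = of_real (2 / \<Lambda>) * poly (pderiv q) (y i) * poly (pderiv p) (y i)"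
      if "i \<in> {1..m}" for i
      using that root_q by (intro residue_power_branch_eq_0_iff[OF q _ assms(8)]) auto
    then show ?thesis
      unfolding condQ_def root_q by blast
  qed
  let ?A = "has_rational_antiderivative_on (\<lambda>z. Q z / (poly p z)\<^sup>2) U"
  let ?B = "has_rational_antiderivative_on (\<lambda>z. P z / (poly q z)\<^sup>2) V"
  have only_if: "\<Lambda> \<in> {1/2, 1, 2} \<and> bilinear_eq \<Lambda> p q" if "2 \<le> n + m" ?A ?B
  proof -
    note ratP = has_rational_antiderivative_onD[OF p q assms(9,11,12,13) \<open>?A\<close>]
    note ratQ = has_rational_antiderivative_onD[OF q p assms(14,16,17,18) \<open>?B\<close>]
    have condP
      unfolding condP_def using ratP(1) pq by blast
    moreover have condQ
      unfolding condQ_def using ratQ(1) pq by blast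
    ultimately have B: "bilinear_eq \<Lambda> p q"
      using bil by blast
    \<comment> \<open>Besides the sign of \<Lambda> this provides a root of each polynomial: a root
      of q makes 2 \<Lambda> an integer, a root of p does so for 2 / \<Lambda>.\<close>
    then have pos: "0 < \<Lambda>" "0 < n" "0 < m"
      using bilinear_eq_imp_pos[OF B lead Lambda] deg \<open>2 \<le> n + m\<close> by auto
    have "poly p (x 1) = 0" "poly q (y 1) = 0"
      using pos root_p root_q by force+
    then show ?thesis
      using B power_exponent_integral_cases[OF pos(1) ratP(2) ratQ(2)] by blast
  qed
  have "if": "?A \<and> ?B" if L: "\<Lambda> \<in> {1/2, 1, 2}" and B: "bilinear_eq \<Lambda> p q"
  proof -
    obtain k l :: nat where kl: "2 * \<Lambda> = real k" "k > 0" "2 / \<Lambda> = real l" "l > 0"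
    proof -
      consider "\<Lambda> = 1/2" | "\<Lambda> = 1" | "\<Lambda> = 2" using L by blast
      then show ?thesis
        using that[of 1 4] that[of 2 2] that[of 4 1] by cases auto
    qed
    have ?A
      by (rule rational_antiderivative_power_branch[OF p assms(12,13) kl(1,2)])
        (use B bil in \<open>auto simp: condP_def\<close>)
    moreover have ?B
      by (rule rational_antiderivative_power_branch[OF q assms(17,18) kl(3,4)])
        (use B bil in \<open>auto simp: condQ_def\<close>)
    ultimately show ?thesis ..
  qed
  show ?thesis
    using resP resQ bil only_if "if" by blast
qed

end
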